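(* Let $a\in\mathbb{C}^k$ and let $Z_1,\dots,Z_k$ be independent random vectors, each uniformly distributed on the real unit sphere $S^{L-1}=\{z\in\mathbb{R}^L:\|z\|_2=1\}$. Then for every $u>1$, $$\mathbb{P}\Big(\Big\|\sum_{j=1}^k a_jZ_j\Big\|_2\ge u\|a\|_2\Big)\le \exp\Big(-\frac{L}{2}\big(u^2-\log(u^2)-1\big)\Big).$$
   Formalization: The formal statement assumes a ≠ 0; for a = 0 the event ‖0‖ ≥ u·0 has probability 1 while the bound is strictly less than 1 for u > 1, so the claim fails there. *)

theory Defs
  imports "HOL-Probability.Probability"
begin

text \<open>Uniform distribution on the real unit sphere S^{L-1} in R^L (L = CARD('n)),
  realised as the normalised cone measure: the push-forward of the uniform
  distribution on the unit ball under radial projection x \<mapsto> x / |x|.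
  This coincides with normalised surface measure on the sphere.\<close>
definition uniform_sphere :: "(real ^ 'n) measure" where
  "uniform_sphere = distr (uniform_measure lborel (ball 0 1)) borel (\<lambda>x. x /\<^sub>R norm x)"

definition cvec :: "real ^ 'n \<Rightarrow> complex ^ 'n" where
  "cvec z = (\<chi> i. complex_of_real (z $ i))"

end

theory Submission
  imports Defs
begin

text \<open>
  This is a Chernoff bound. For real coefficients, \<open>exp (s * \<bar>X\<bar>\<^sup>2)\<close> is the average of
  \<open>exp (sqrt (2 * s) * (g \<bullet> X))\<close> over a standard Gaussian vector \<open>g\<close>. Conditionally on \<open>g\<close> the
  summands factorise, and each factor is controlled by the sub-Gaussian estimate
  \<open>E (exp (v \<bullet> Z)) \<le> exp (\<bar>v\<bar>\<^sup>2 / (2 * L))\<close> for the uniform distribution on the sphere. Integrating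
  out \<open>g\<close> gives \<open>(1 - 2 * s / L) powr (- L / 2)\<close> for unit coefficient vectors.
  For complex coefficients the squared norm of the sum is the sum of those of its real and imaginary
  parts, and convexity of the exponential with weights \<open>\<bar>Re a\<bar>\<^sup>2 / \<bar>a\<bar>\<^sup>2\<close> and
  \<open>\<bar>Im a\<bar>\<^sup>2 / \<bar>a\<bar>\<^sup>2\<close> yields the same bound. The optimal parameter is \<open>s = L / 2 * (1 - 1 / u\<^sup>2)\<close>.
\<close>

section \<open>The uniform distribution on the sphere and polar decomposition of Lebesgue
  measure\<close>

lemma nn_integral_lborel_scaleR:
  fixes f :: "'a::euclidean_space \<Rightarrow> ennreal"
  assumes [measurable]: "f \<in> borel_measurable borel" and "c \<noteq> 0"
  shows "(\<integral>\<^sup>+x. f x \<partial>lborel) = ennreal (\<bar>c\<bar> ^ DIM('a)) * (\<integral>\<^sup>+x. f (c *\<^sub>R x) \<partial>lborel)"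
  by (subst lborel_affine[OF assms(2), of 0])
     (simp add: nn_integral_density nn_integral_distr nn_integral_cmult)

lemma emeasure_lborel_unit_ball:
  "emeasure lborel (ball (0::'a::euclidean_space) 1) \<noteq> 0"
  "emeasure lborel (ball (0::'a::euclidean_space) 1) \<noteq> \<infinity>"
proof -
  show "emeasure lborel (ball (0::'a) 1) \<noteq> \<infinity>"
    using emeasure_lborel_ball_finite[of "0::'a" 1] by simp
  show "emeasure lborel (ball (0::'a) 1) \<noteq> 0"
    using content_ball_pos[of 1 "0::'a"] by (auto simp: measure_def)
qed

lemma sets_uniform_sphere [measurable_cong, simp]: "sets uniform_sphere = sets borel"
  by (simp add: uniform_sphere_def)

lemma nn_integral_uniform_sphere:
  fixes h :: "real ^ 'n \<Rightarrow> ennreal"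
  assumes [measurable]: "h \<in> borel_measurable borel"
  shows "(\<integral>\<^sup>+z. h z \<partial>uniform_sphere) =
    (\<integral>\<^sup>+x. h (x /\<^sub>R norm x) * indicator (ball 0 1) x \<partial>lborel) / emeasure lborel (ball (0::real^'n) 1)"
  unfolding uniform_sphere_def
  by (simp add: nn_integral_distr nn_integral_uniform_measure)

lemma prob_space_uniform_sphere: "prob_space (uniform_sphere :: (real ^ 'n) measure)"
  unfolding uniform_sphere_def
  by (intro prob_space.prob_space_distr prob_space_uniform_measure emeasure_lborel_unit_ball) simp

text \<open>Reflection at the origin preserves Lebesgue measure and the unit ball and commutes with
  radial projection.\<close>

lemma nn_integral_uniform_sphere_uminus:
  fixes h :: "real ^ 'n \<Rightarrow> ennreal"
  assumes [measurable]: "h \<in> borel_measurable borel"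
  shows "(\<integral>\<^sup>+z. h (- z) \<partial>uniform_sphere) = (\<integral>\<^sup>+z. h z \<partial>uniform_sphere)"
proof -
  have "(\<integral>\<^sup>+x. h (x /\<^sub>R norm x) * indicator (ball 0 1) x \<partial>lborel) =
        (\<integral>\<^sup>+x. h (- (x /\<^sub>R norm x)) * indicator (ball 0 1) x \<partial>lborel)"
    by (subst nn_integral_lborel_scaleR[where c = "-1"]) (auto simp: indicator_def)
  then show ?thesis by (simp add: nn_integral_uniform_sphere)
qed

text \<open>Norm and direction are independent under Lebesgue measure. As functionals of
  \<open>f\<close>, both sides are integrals against measures on the real line, \<open>N1\<close>
  and \<open>N2\<close>. These agree on every \<open>{..<r}\<close>, since the direction is
  invariant under positive scaling and both masses scale from the unit ball by the same power of
  \<open>r\<close>. Finiteness of the integral of \<open>h\<close> makes the exhausting half-lines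
  have finite mass, so agreement on this intersection-stable generator suffices.\<close>

lemma nn_integral_radial_times_direction:
  fixes f :: "real \<Rightarrow> ennreal" and h :: "real ^ 'n \<Rightarrow> ennreal"
  assumes [measurable]: "f \<in> borel_measurable borel" "h \<in> borel_measurable borel"
    and fin: "(\<integral>\<^sup>+z. h z \<partial>uniform_sphere) \<noteq> \<infinity>"
  shows "(\<integral>\<^sup>+x. f (norm x) * h (x /\<^sub>R norm x) \<partial>lborel) =
         (\<integral>\<^sup>+(x :: real ^ 'n). f (norm x) \<partial>lborel) * (\<integral>\<^sup>+z. h z \<partial>uniform_sphere)"
proof -
  define E where "E = (\<integral>\<^sup>+z. h z \<partial>uniform_sphere)"
  define N1 where "N1 = distr (density lborel (\<lambda>x. h (x /\<^sub>R norm x))) borel (norm :: real ^ 'n \<Rightarrow> real)"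
  define N2 where "N2 = scale_measure E (distr lborel borel (norm :: real ^ 'n \<Rightarrow> real))"
  have N1: "emeasure N1 {..<r} = (\<integral>\<^sup>+x. h (x /\<^sub>R norm x) * indicator (ball 0 r) x \<partial>lborel)" for r
  proof -
    have "norm -` {..<r} = ball (0 :: real ^ 'n) r" by auto
    then show ?thesis unfolding N1_def by (simp add: emeasure_distr emeasure_density)
  qed
  have N2: "emeasure N2 {..<r} = E * emeasure lborel (ball (0 :: real ^ 'n) r)" for r
  proof -
    have "norm -` {..<r} = ball (0 :: real ^ 'n) r" by auto
    then show ?thesis unfolding N2_def by (simp add: emeasure_distr)
  qed
  \<comment> \<open>The case \<open>r = 1\<close>: this is the definition of the cone measure,
    multiplied by the volume of the ball, which is neither zero nor infinite.\<close>
  have EB: "E * emeasure lborel (ball (0 :: real ^ 'n) 1) =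
      (\<integral>\<^sup>+x. h (x /\<^sub>R norm x) * indicator (ball 0 1) x \<partial>lborel)"
    unfolding E_def nn_integral_uniform_sphere[OF assms(2)]
    using emeasure_lborel_unit_ball[where 'a = "real ^ 'n"]
    by (simp add: ennreal_divide_times ennreal_divide_self less_top)
  have eq: "emeasure N1 {..<r} = emeasure N2 {..<r}" for r
  proof (cases "r > 0")
    case True
    have ind: "indicator (ball 0 r) (r *\<^sub>R x) = (indicator (ball 0 1) x :: ennreal)" for x :: "real ^ 'n"
      using True by (auto simp: indicator_def)
    have dir: "(r *\<^sub>R x) /\<^sub>R norm (r *\<^sub>R x) = x /\<^sub>R norm x" for x :: "real ^ 'n"
      using True by simp
    have "emeasure lborel (ball (0 :: real ^ 'n) r) = (\<integral>\<^sup>+(x :: real ^ 'n). indicator (ball 0 r) x \<partial>lborel)"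
      by simp
    also have "\<dots> = ennreal (r ^ DIM(real ^ 'n)) * emeasure lborel (ball (0 :: real ^ 'n) 1)"
      using True by (subst nn_integral_lborel_scaleR[where c = r]) (simp_all add: ind borel_measurable_indicator)
    finally have B: "emeasure lborel (ball (0 :: real ^ 'n) r) = \<dots>" .
    have meas: "(\<lambda>x. h (x /\<^sub>R norm x) * indicator (ball 0 r) x) \<in> borel_measurable borel"
      by (intro borel_measurable_times_ennreal borel_measurable_indicator) simp_all
    have "emeasure N1 {..<r} = ennreal (r ^ DIM(real ^ 'n)) *
        (\<integral>\<^sup>+x. h (x /\<^sub>R norm x) * indicator (ball 0 1) x \<partial>lborel)"
      unfolding N1 using True
      by (subst nn_integral_lborel_scaleR[OF meas, of r]) (simp_all only: ind dir, simp_all)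
    then show ?thesis unfolding N2 B EB[symmetric] by (simp add: ac_simps)
  next
    case False
    then have empty: "ball (0 :: real ^ 'n) r = {}" by simp
    show ?thesis unfolding N1 N2 empty by simp
  qed
  have "N1 = N2"
  proof (rule measure_eqI_generator_eq[where \<Omega> = UNIV and E = "range lessThan" and A = "\<lambda>i. {..<real i}"])
    show "Int_stable (range lessThan :: real set set)"
    proof (rule Int_stableI, safe)
      fix x y :: real show "{..<x} \<inter> {..<y} \<in> range lessThan" 
        by (rule image_eqI[of _ _ "min x y"]) auto
    qed
    have "sets (borel :: real measure) = sigma_sets UNIV (range lessThan)"
      by (subst borel_Iio) simp
    then show "sets N1 = sigma_sets UNIV (range lessThan)" "sets N2 = sigma_sets UNIV (range lessThan)"
      by (simp_all add: N1_def N2_def)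
    show "(\<Union>i. {..<real i}) = UNIV"
      using reals_Archimedean2 by auto
    show "emeasure N1 {..<real i} \<noteq> \<infinity>" for i
      unfolding eq N2 using fin emeasure_lborel_ball_finite[of "0 :: real ^ 'n" "real i"]
      by (simp add: E_def ennreal_mult_eq_top_iff)
  qed (use eq in auto)
  have "(\<integral>\<^sup>+x. f (norm x) * h (x /\<^sub>R norm x) \<partial>lborel) = (\<integral>\<^sup>+r. f r \<partial>N1)"
    unfolding N1_def by (simp add: nn_integral_distr nn_integral_density mult.commute)
  also have "\<dots> = E * (\<integral>\<^sup>+(x :: real ^ 'n). f (norm x) \<partial>lborel)"
    unfolding \<open>N1 = N2\<close> N2_def by (simp add: nn_integral_scale_measure nn_integral_distr)
  finally show ?thesis by (simp add: E_def mult.commute)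
qed

section \<open>A tangent inequality for the hyperbolic cosine\<close>

text \<open>As a function of \<open>t = r\<^sup>2\<close>, \<open>cosh (r * y)\<close> is a power
  series with nonnegative coefficients, hence convex, and \<open>y * sinh y / 2\<close> is its slope
  at \<open>t = 1\<close>. This is the tangent bound there, arranged so that every term is
  nonnegative and can be integrated in \<open>ennreal\<close>.\<close>

lemma cosh_scale_ge_tangent:
  fixes r y :: real
  shows "cosh y + r\<^sup>2 * (y * sinh y / 2) \<le> cosh (r * y) + y * sinh y / 2"
proof -
  \<comment> \<open>Multiplying the series of \<open>sinh\<close> by \<open>y\<close> shifts its odd
    powers to even ones, which aligns it with the series of \<open>cosh\<close>; the term at index 0
    vanishes.\<close>
  have ys: "(\<lambda>n. if even n then real n * (y ^ n / fact n) else 0) sums (y * sinh y)"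
  proof -
    have "(\<lambda>n. y * (if even n then 0 else y ^ n /\<^sub>R fact n)) sums (y * sinh y)"
      by (intro sums_mult sinh_converges)
    also have "(\<lambda>n. y * (if even n then 0 else y ^ n /\<^sub>R fact n)) =
      (\<lambda>n. if even (Suc n) then real (Suc n) * (y ^ Suc n / fact (Suc n)) else 0)"
      by (auto simp: fun_eq_iff field_simps simp del: of_nat_Suc)
    finally show ?thesis by (subst (asm) sums_Suc_iff) simp
  qed
  have "cosh y + (r\<^sup>2 - 1) / 2 * (y * sinh y) \<le> cosh (r * y)"
  proof (rule sums_le)
    show "(\<lambda>n. (if even n then y ^ n /\<^sub>R fact n else 0) +
       (r\<^sup>2 - 1) / 2 * (if even n then real n * (y ^ n / fact n) else 0)) sums
       (cosh y + (r\<^sup>2 - 1) / 2 * (y * sinh y))"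
      by (intro sums_add sums_mult cosh_converges ys)
    show "(\<lambda>n. if even n then (r * y) ^ n /\<^sub>R fact n else 0) sums cosh (r * y)"
      by (rule cosh_converges)
    fix n
    show "(if even n then y ^ n /\<^sub>R fact n else 0) +
       (r\<^sup>2 - 1) / 2 * (if even n then real n * (y ^ n / fact n) else 0)
       \<le> (if even n then (r * y) ^ n /\<^sub>R fact n else 0)"
    proof (cases "even n")
      case True
      then obtain m where m: "n = 2 * m" by blast
      \<comment> \<open>Termwise, the claim is the tangent bound for \<open>t ^ m\<close> at
        \<open>t = 1\<close>, that is Bernoulli's inequality.\<close>
      have "1 + real m * (r\<^sup>2 - 1) \<le> (1 + (r\<^sup>2 - 1)) ^ m"
        by (rule Bernoulli_inequality) simp
      then have "(1 + real m * (r\<^sup>2 - 1)) * (y ^ n / fact n) \<le> r ^ n * (y ^ n / fact n)"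
        by (intro mult_right_mono) (auto simp: m power_mult)
      then show ?thesis using True
        by (simp add: m power_mult_distrib field_simps)
    qed simp
  qed
  then show ?thesis by (simp add: field_simps)
qed

section \<open>Standard Gaussian vectors and their exponential moments\<close>

text \<open>The product form lets integrals of coordinatewise products split into one-dimensional
  ones; the radial form, needed for polar decomposition, is \<open>gauss_density_eq\<close>.\<close>

definition gauss_density :: "'a::euclidean_space \<Rightarrow> real" where
  "gauss_density x = (\<Prod>b\<in>Basis. std_normal_density (x \<bullet> b))"

lemma gauss_density_nonneg [simp]: "0 \<le> gauss_density x"
  by (simp add: gauss_density_def prod_nonneg)

lemma borel_measurable_gauss_density [measurable]: "gauss_density \<in> borel_measurable borel"
  unfolding gauss_density_def[abs_def] by measurable

lemma norm_sq_eq_sum_Basis: "(norm x)\<^sup>2 = (\<Sum>b\<in>Basis. (x \<bullet> b)\<^sup>2)"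
  unfolding power2_norm_eq_inner by (subst euclidean_inner) (simp add: power2_eq_square)

lemma gauss_density_eq:
  fixes x :: "'a::euclidean_space"
  shows "gauss_density x = (1 / sqrt (2 * pi)) ^ DIM('a) * exp (- (norm x)\<^sup>2 / 2)"
  unfolding gauss_density_def std_normal_density_def prod.distrib norm_sq_eq_sum_Basis
  by (simp add: exp_sum[symmetric] sum_negf sum_divide_distrib)

lemma nn_integral_gauss_density_prod:
  fixes f :: "'a::euclidean_space \<Rightarrow> real \<Rightarrow> ennreal"
  assumes [measurable]: "\<And>b. b \<in> Basis \<Longrightarrow> f b \<in> borel_measurable borel"
  shows "(\<integral>\<^sup>+x. ennreal (gauss_density x) * (\<Prod>b\<in>Basis. f b (x \<bullet> b)) \<partial>lborel) =
         (\<Prod>b\<in>Basis. \<integral>\<^sup>+x. ennreal (std_normal_density x) * f b x \<partial>lborel)"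
  unfolding gauss_density_def prod_ennreal[OF normal_density_nonneg, symmetric] prod.distrib[symmetric]
  by (rule nn_integral_lborel_prod) simp_all

lemma nn_integral_normal_density:
  "0 < \<sigma> \<Longrightarrow> (\<integral>\<^sup>+x. ennreal (normal_density \<mu> \<sigma> x) \<partial>lborel) = 1"
  using prob_space.emeasure_space_1[OF prob_space_normal_density, of \<sigma> \<mu>]
  by (simp add: emeasure_density)

text \<open>Completing the square: the integrand is \<open>exp (c\<^sup>2 / 2)\<close> times the
  normal density with mean \<open>c\<close> and variance 1.\<close>

lemma nn_integral_std_normal_exp:
  "(\<integral>\<^sup>+x. ennreal (std_normal_density x) * ennreal (exp (c * x)) \<partial>lborel) = ennreal (exp (c\<^sup>2 / 2))"
proof -
  have "std_normal_density x * exp (c * x) = exp (c\<^sup>2 / 2) * normal_density c 1 x" for x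
    unfolding normal_density_def
    by (simp add: mult_exp_exp) (simp add: power2_eq_square field_simps)
  then have "(\<integral>\<^sup>+x. ennreal (std_normal_density x) * ennreal (exp (c * x)) \<partial>lborel) =
    (\<integral>\<^sup>+x. ennreal (exp (c\<^sup>2 / 2)) * ennreal (normal_density c 1 x) \<partial>lborel)"
    by (simp add: ennreal_mult[symmetric])
  then show ?thesis by (simp add: nn_integral_cmult nn_integral_normal_density)
qed

text \<open>The integrand is \<open>\<sigma>\<close> times the centred normal density with variance
  \<open>\<sigma>\<^sup>2 = 1 / (1 - 2 * t)\<close>.\<close>

lemma nn_integral_std_normal_exp_sq:
  assumes "t < 1 / 2"
  shows "(\<integral>\<^sup>+x. ennreal (std_normal_density x) * ennreal (exp (t * x\<^sup>2)) \<partial>lborel) =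
         ennreal (1 / sqrt (1 - 2 * t))"
proof -
  define \<sigma> where "\<sigma> = 1 / sqrt (1 - 2 * t)"
  have \<sigma>: "\<sigma> > 0" "\<sigma>\<^sup>2 = 1 / (1 - 2 * t)" using assms by (simp_all add: \<sigma>_def power_divide)
  have "std_normal_density x * exp (t * x\<^sup>2) = \<sigma> * normal_density 0 \<sigma> x" for x
  proof -
    have "- x\<^sup>2 / 2 + t * x\<^sup>2 = - x\<^sup>2 / (2 * \<sigma>\<^sup>2)" using assms by (simp add: \<sigma> field_simps)
    then have "exp (- x\<^sup>2 / 2) * exp (t * x\<^sup>2) = exp (- x\<^sup>2 / (2 * \<sigma>\<^sup>2))" by (simp only: mult_exp_exp)
    moreover have "sqrt (2 * pi * \<sigma>\<^sup>2) = sqrt (2 * pi) * \<sigma>" using \<sigma>(1) by (simp add: real_sqrt_mult)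
    ultimately show ?thesis using \<sigma>(1) unfolding normal_density_def by simp
  qed
  then have "(\<integral>\<^sup>+x. ennreal (std_normal_density x) * ennreal (exp (t * x\<^sup>2)) \<partial>lborel) =
    (\<integral>\<^sup>+x. ennreal \<sigma> * ennreal (normal_density 0 \<sigma> x) \<partial>lborel)"
    using \<sigma> by (simp add: ennreal_mult[symmetric])
  then show ?thesis using \<sigma>(1) 
    by (simp add: nn_integral_cmult nn_integral_normal_density) (simp add: \<sigma>_def)
qed

lemma nn_integral_std_normal_sq:
  "(\<integral>\<^sup>+x. ennreal (std_normal_density x) * ennreal (x\<^sup>2) \<partial>lborel) = 1"
proof -
  have "has_bochner_integral lborel (\<lambda>x. std_normal_density x * x\<^sup>2) 1"
    using std_normal_moment_even[of 1] by simp
  then have "(\<integral>\<^sup>+x. ennreal (std_normal_density x * x\<^sup>2) \<partial>lborel) = ennreal 1"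
    by (subst nn_integral_eq_integral) (auto simp: has_bochner_integral_iff)
  then show ?thesis by (simp add: ennreal_mult)
qed

text \<open>Read from right to left, this linearises the exponential of a squared norm at the price
  of an auxiliary Gaussian vector.\<close>

lemma nn_integral_gauss_exp_inner:
  fixes v :: "'a::euclidean_space"
  shows "(\<integral>\<^sup>+x. ennreal (gauss_density x) * ennreal (exp (x \<bullet> v)) \<partial>lborel) =
         ennreal (exp ((norm v)\<^sup>2 / 2))"
proof -
  have "ennreal (exp (x \<bullet> v)) = (\<Prod>b\<in>Basis. ennreal (exp ((v \<bullet> b) * (x \<bullet> b))))" for x :: 'a
    by (subst euclidean_inner) (simp add: prod_ennreal exp_sum mult.commute)
  then have "(\<integral>\<^sup>+x. ennreal (gauss_density x) * ennreal (exp (x \<bullet> v)) \<partial>lborel) =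
      (\<Prod>b\<in>Basis. ennreal (exp ((v \<bullet> b)\<^sup>2 / 2)))"
    using nn_integral_gauss_density_prod[of "\<lambda>b y. ennreal (exp ((v \<bullet> b) * y))"]
    by (simp add: nn_integral_std_normal_exp)
  then show ?thesis
    by (simp add: prod_ennreal exp_sum[symmetric] norm_sq_eq_sum_Basis sum_divide_distrib)
qed

lemma nn_integral_gauss_density:
  "(\<integral>\<^sup>+(x::'a::euclidean_space). ennreal (gauss_density x) \<partial>lborel) = 1"
  using nn_integral_gauss_exp_inner[of "0::'a"] by simp

lemma nn_integral_gauss_exp_norm_sq:
  assumes "t < 1 / 2"
  shows "(\<integral>\<^sup>+(x::'a::euclidean_space). ennreal (gauss_density x) * ennreal (exp (t * (norm x)\<^sup>2)) \<partial>lborel) =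
         ennreal ((1 / sqrt (1 - 2 * t)) ^ DIM('a))"
proof -
  have "ennreal (exp (t * (norm x)\<^sup>2)) = (\<Prod>b\<in>Basis. ennreal (exp (t * (x \<bullet> b)\<^sup>2)))" for x :: 'a
    by (simp add: norm_sq_eq_sum_Basis prod_ennreal exp_sum sum_distrib_left)
  then show ?thesis
    using nn_integral_gauss_density_prod[of "\<lambda>(b::'a) y. ennreal (exp (t * y\<^sup>2))"] assms
    by (simp add: nn_integral_std_normal_exp_sq ennreal_power)
qed

lemma nn_integral_gauss_norm_sq:
  "(\<integral>\<^sup>+(x::'a::euclidean_space). ennreal (gauss_density x) * ennreal ((norm x)\<^sup>2) \<partial>lborel) =
   of_nat DIM('a)"
proof -
  have coord: "(\<integral>\<^sup>+(x::'a). ennreal (gauss_density x) * ennreal ((x \<bullet> b)\<^sup>2) \<partial>lborel) = 1"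
    if b: "b \<in> Basis" for b
  proof -
    \<comment> \<open>A single squared coordinate is written as a product with factors 1 elsewhere,
      so that the product rule applies.\<close>
    have "(\<Prod>c\<in>Basis. if c = b then ennreal ((x \<bullet> c)\<^sup>2) else 1) = ennreal ((x \<bullet> b)\<^sup>2)" for x
      using b by simp
    moreover have "(\<integral>\<^sup>+y. ennreal (std_normal_density y) * (if c = b then ennreal (y\<^sup>2) else 1) \<partial>lborel) = 1"
      for c
      by (cases "c = b") (simp_all add: nn_integral_std_normal_sq nn_integral_normal_density)
    ultimately show ?thesis
      using nn_integral_gauss_density_prod[of "\<lambda>c y. if c = b then ennreal (y\<^sup>2) else 1"] by simp
  qed
  have "ennreal ((norm x)\<^sup>2) = (\<Sum>b\<in>Basis. ennreal ((x \<bullet> b)\<^sup>2))" for x :: 'a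
    by (simp add: norm_sq_eq_sum_Basis sum_ennreal)
  then have "(\<integral>\<^sup>+(x::'a). ennreal (gauss_density x) * ennreal ((norm x)\<^sup>2) \<partial>lborel) =
    (\<Sum>b\<in>Basis. \<integral>\<^sup>+(x::'a). ennreal (gauss_density x) * ennreal ((x \<bullet> b)\<^sup>2) \<partial>lborel)"
    by (simp add: sum_distrib_left nn_integral_sum del: sum_ennreal)
  then show ?thesis by (simp add: coord)
qed

section \<open>The sub-Gaussian estimate for the uniform distribution on the sphere\<close>

lemma nn_integral_uniform_sphere_continuous_finite:
  fixes h :: "real ^ 'n \<Rightarrow> real"
  assumes "continuous_on UNIV h"
  shows "(\<integral>\<^sup>+z. ennreal (h z) \<partial>uniform_sphere) \<noteq> \<infinity>"
proof -
  have "bounded (h ` cball 0 1)"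
    by (intro compact_imp_bounded compact_continuous_image continuous_on_subset[OF assms]) auto
  then obtain B where B: "\<And>z. norm z \<le> 1 \<Longrightarrow> \<bar>h z\<bar> \<le> B"
    unfolding bounded_iff by (metis dist_0_norm image_eqI mem_cball real_norm_def)
  have [measurable]: "h \<in> borel_measurable borel"
    using assms by (rule borel_measurable_continuous_onI)
  \<comment> \<open>The bound by 1, unlike equality, also holds for the image of the origin, which
    radial projection sends to 0; no null set has to be removed.\<close>
  have "AE z in uniform_sphere. norm (z :: real ^ 'n) \<le> 1"
    unfolding uniform_sphere_def by (subst AE_distr_iff) (auto intro!: AE_I2 simp: divide_inverse[symmetric] mult.commute[of "inverse _"] divide_le_eq_1)
  then have "(\<integral>\<^sup>+z. ennreal (h z) \<partial>uniform_sphere) \<le> (\<integral>\<^sup>+(z :: real ^ 'n). ennreal B \<partial>uniform_sphere)"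
    by (intro nn_integral_mono_AE) (auto elim!: eventually_mono intro!: ennreal_leI dest: B)
  also have "\<dots> < \<infinity>"
    by (simp add: prob_space.emeasure_space_1[OF prob_space_uniform_sphere])
  finally show ?thesis by simp
qed

lemma ennreal_cosh: "ennreal (cosh y) = ennreal (1 / 2) * (ennreal (exp y) + ennreal (exp (- y)))"
proof -
  have "cosh y = 1 / 2 * (exp y + exp (- y))" by (simp add: cosh_field_def)
  then show ?thesis
    by (simp only: ennreal_mult ennreal_plus exp_ge_zero add_nonneg_nonneg zero_le_divide_1_iff zero_le_numeral)
qed

lemma ennreal_half_double: "ennreal (1 / 2) * (x + x) = x"
proof -
  have "ennreal (1 / 2) * (x + x) = (ennreal (1 / 2) + ennreal (1 / 2)) * x"
    by (simp add: distrib_left distrib_right)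
  also have "ennreal (1 / 2) + ennreal (1 / 2) = 1"
    by (subst ennreal_plus[symmetric]) (simp_all del: ennreal_plus)
  finally show ?thesis by simp
qed

text \<open>A Gaussian vector is its norm times an independent uniform direction, and its squared norm
  has mean the dimension. Since \<open>cosh (r * y)\<close> is convex in \<open>r\<^sup>2\<close>, Jensen's inequality
  shows that replacing the norm by the root of that mean decreases the moment generating function.\<close>
lemma uniform_sphere_subgaussian:
  fixes v :: "real ^ 'n"
  shows "(\<integral>\<^sup>+z. ennreal (exp (v \<bullet> z)) \<partial>uniform_sphere) \<le> ennreal (exp ((norm v)\<^sup>2 / (2 * real CARD('n))))"
proof -
  define L where "L = real CARD('n)"
  have L: "L > 0" by (simp add: L_def)
  define q :: "real \<Rightarrow> real" where "q y = y * sinh y / 2" for y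
  have q0: "0 \<le> q y" for y
    by (auto simp: q_def zero_le_mult_iff)
  have [measurable]: "q \<in> borel_measurable borel" "cosh \<in> borel_measurable (borel :: real measure)"
    unfolding q_def by (auto intro!: borel_measurable_continuous_onI continuous_intros)
  define \<phi> where "\<phi> r = (1 / sqrt (2 * pi)) ^ CARD('n) * exp (- r\<^sup>2 / 2)" for r :: real
  have \<phi>: "gauss_density x = \<phi> (norm x)" for x :: "real ^ 'n"
    by (simp add: gauss_density_eq \<phi>_def)
  have \<phi>0: "0 \<le> \<phi> r" for r by (simp add: \<phi>_def)
  have [measurable]: "\<phi> \<in> borel_measurable borel" unfolding \<phi>_def by measurable
  define C where "C = (\<integral>\<^sup>+z. ennreal (cosh (v \<bullet> z)) \<partial>uniform_sphere)"
  define Q where "Q = (\<integral>\<^sup>+z. ennreal (q (v \<bullet> z)) \<partial>uniform_sphere)"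
  have Cfin: "C \<noteq> \<infinity>" unfolding C_def
    by (intro nn_integral_uniform_sphere_continuous_finite continuous_intros)
  have Qfin: "Q \<noteq> \<infinity>" unfolding Q_def q_def
    by (intro nn_integral_uniform_sphere_continuous_finite continuous_intros) auto
  have one: "(\<integral>\<^sup>+(x :: real ^ 'n). ennreal (\<phi> (norm x)) \<partial>lborel) = 1"
    using nn_integral_gauss_density[where 'a = "real ^ 'n"] by (simp add: \<phi>)
  \<comment> \<open>The squared ratio \<open>(norm x / sqrt L)\<^sup>2\<close> has Gaussian mean 1,
    the point of tangency. Hence the two slope terms in \<open>pt\<close> have the same integral
    \<open>Q\<close>.\<close>
  have two: "(\<integral>\<^sup>+(x :: real ^ 'n). ennreal (\<phi> (norm x)) * ennreal ((norm x)\<^sup>2 / L) \<partial>lborel) = 1"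
  proof -
    have "(\<integral>\<^sup>+(x :: real ^ 'n). ennreal (\<phi> (norm x)) * ennreal ((norm x)\<^sup>2 / L) \<partial>lborel) =
      (\<integral>\<^sup>+(x :: real ^ 'n). ennreal (1 / L) * (ennreal (gauss_density x) * ennreal ((norm x)\<^sup>2)) \<partial>lborel)"
      using L by (simp add: \<phi> \<phi>0 ennreal_mult[symmetric] ac_simps)
    also have "\<dots> = ennreal (1 / L) * of_nat CARD('n)"
      by (simp add: nn_integral_cmult nn_integral_gauss_norm_sq)
    also have "\<dots> = 1"
      using L by (simp add: L_def ennreal_of_nat_eq_real_of_nat ennreal_mult[symmetric])
    finally show ?thesis .
  qed
  \<comment> \<open>The tangent inequality with \<open>r = norm x / sqrt L\<close> and
    \<open>y\<close> the inner product of \<open>v\<close> with the direction of \<open>x\<close>;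
    then \<open>r * y\<close> is linear in \<open>x\<close>, and its Gaussian integral is
    explicit.\<close>
  have pt: "gauss_density x * cosh (v \<bullet> (x /\<^sub>R norm x)) + gauss_density x * ((norm x)\<^sup>2 / L) * q (v \<bullet> (x /\<^sub>R norm x))
      \<le> gauss_density x * cosh (x \<bullet> (v /\<^sub>R sqrt L)) + gauss_density x * q (v \<bullet> (x /\<^sub>R norm x))" for x
  proof -
    define y where "y = v \<bullet> (x /\<^sub>R norm x)"
    have ry: "norm x / sqrt L * y = x \<bullet> (v /\<^sub>R sqrt L)"
      using L by (cases "x = 0") (simp_all add: y_def inner_commute field_simps)
    have "cosh y + (norm x / sqrt L)\<^sup>2 * q y \<le> cosh (norm x / sqrt L * y) + q y"
      unfolding q_def by (rule cosh_scale_ge_tangent)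
    then have "cosh y + (norm x)\<^sup>2 / L * q y \<le> cosh (x \<bullet> (v /\<^sub>R sqrt L)) + q y"
      using L unfolding ry by (simp add: power_divide)
    from mult_left_mono[OF this gauss_density_nonneg[of x]]
    show ?thesis by (simp add: y_def algebra_simps)
  qed
  have "C + Q =
    (\<integral>\<^sup>+x. ennreal (\<phi> (norm x)) * ennreal (cosh (v \<bullet> (x /\<^sub>R norm x))) \<partial>lborel) +
    (\<integral>\<^sup>+x. (ennreal (\<phi> (norm x)) * ennreal ((norm x)\<^sup>2 / L)) * ennreal (q (v \<bullet> (x /\<^sub>R norm x))) \<partial>lborel)"
    using nn_integral_radial_times_direction[of "\<lambda>r. ennreal (\<phi> r)" "\<lambda>z. ennreal (cosh (v \<bullet> z))"]
      nn_integral_radial_times_direction[of "\<lambda>r. ennreal (\<phi> r) * ennreal (r\<^sup>2 / L)" "\<lambda>z. ennreal (q (v \<bullet> z))"]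
      Cfin Qfin by (simp add: one two C_def Q_def)
  also have "\<dots> = (\<integral>\<^sup>+x. ennreal (gauss_density x * cosh (v \<bullet> (x /\<^sub>R norm x)) +
      gauss_density x * ((norm x)\<^sup>2 / L) * q (v \<bullet> (x /\<^sub>R norm x))) \<partial>lborel)"
    using L by (subst nn_integral_add[symmetric])
      (simp_all add: \<phi> \<phi>0 q0 ennreal_mult del: times_divide_eq_left times_divide_eq_right)
  also have "\<dots> \<le> (\<integral>\<^sup>+x. ennreal (gauss_density x * cosh (x \<bullet> (v /\<^sub>R sqrt L)) +
      gauss_density x * q (v \<bullet> (x /\<^sub>R norm x))) \<partial>lborel)"
    by (intro nn_integral_mono ennreal_leI pt)
  also have "\<dots> = (\<integral>\<^sup>+x. ennreal (gauss_density x) * ennreal (cosh (x \<bullet> (v /\<^sub>R sqrt L))) \<partial>lborel) +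
     (\<integral>\<^sup>+x. ennreal (\<phi> (norm x)) * ennreal (q (v \<bullet> (x /\<^sub>R norm x))) \<partial>lborel)"
    by (subst nn_integral_add[symmetric]) (simp_all add: \<phi> \<phi>0 q0 ennreal_mult)
  also have "(\<integral>\<^sup>+x. ennreal (\<phi> (norm x)) * ennreal (q (v \<bullet> (x /\<^sub>R norm x))) \<partial>lborel) = Q"
    using nn_integral_radial_times_direction[of "\<lambda>r. ennreal (\<phi> r)" "\<lambda>z. ennreal (q (v \<bullet> z))"]
      Qfin by (simp add: one Q_def)
  also have "(\<integral>\<^sup>+x. ennreal (gauss_density x) * ennreal (cosh (x \<bullet> (v /\<^sub>R sqrt L))) \<partial>lborel) =
    ennreal (1 / 2) * ((\<integral>\<^sup>+x. ennreal (gauss_density x) * ennreal (exp (x \<bullet> (v /\<^sub>R sqrt L))) \<partial>lborel) +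
      (\<integral>\<^sup>+x. ennreal (gauss_density x) * ennreal (exp (x \<bullet> (- (v /\<^sub>R sqrt L)))) \<partial>lborel))"
    unfolding ennreal_cosh inner_minus_right
    by (subst nn_integral_add[symmetric], simp, simp, subst nn_integral_cmult[symmetric], simp)
       (simp add: distrib_left ac_simps)
  also have "\<dots> = ennreal (exp ((norm v)\<^sup>2 / (2 * L)))"
    unfolding nn_integral_gauss_exp_inner norm_minus_cancel ennreal_half_double
    using L by (simp add: power_divide power_mult_distrib power_inverse field_simps)
  \<comment> \<open>The chain bounds \<open>C + Q\<close> by the Gaussian value plus
    \<open>Q\<close>; finiteness of \<open>Q\<close> permits cancellation.\<close>
  finally have "C \<le> ennreal (exp ((norm v)\<^sup>2 / (2 * L)))"
    using Qfin by (simp add: add.commute[of _ Q] ennreal_add_left_cancel_le)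
  \<comment> \<open>Symmetry of the sphere under negation lets \<open>cosh\<close> stand in for
    \<open>exp\<close>.\<close>
  moreover have "C = (\<integral>\<^sup>+z. ennreal (exp (v \<bullet> z)) \<partial>uniform_sphere)"
  proof -
    have "C = ennreal (1 / 2) * ((\<integral>\<^sup>+z. ennreal (exp (v \<bullet> z)) \<partial>uniform_sphere) +
        (\<integral>\<^sup>+z. ennreal (exp (v \<bullet> (- z))) \<partial>uniform_sphere))"
      unfolding C_def ennreal_cosh inner_minus_right
      by (subst nn_integral_add[symmetric], simp, simp, subst nn_integral_cmult[symmetric], simp) simp
    also have "(\<integral>\<^sup>+z. ennreal (exp (v \<bullet> (- z))) \<partial>uniform_sphere) = (\<integral>\<^sup>+z. ennreal (exp (v \<bullet> z)) \<partial>uniform_sphere)"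
      by (rule nn_integral_uniform_sphere_uminus[of "\<lambda>z. ennreal (exp (v \<bullet> z))"]) simp
    finally show ?thesis by (simp only: ennreal_half_double)
  qed
  ultimately show ?thesis by (simp add: L_def)
qed

section \<open>Exponential moments of the squared norm for real coefficients\<close>

text \<open>The square is linearised by a Gaussian \<open>g\<close>, and Tonelli moves the
  expectation over the \<open>Z j\<close> inside, where independence factorises it. What remains is
  the Gaussian integral of \<open>exp (s * A / L * (norm g)\<^sup>2)\<close>, finite because the
  condition on \<open>s\<close> says \<open>s * A / L < 1 / 2\<close>.\<close>

lemma (in prob_space) nn_integral_exp_norm_sq_sphere_sum_le:
  fixes Z :: "'k::finite \<Rightarrow> 'a \<Rightarrow> real ^ 'n" and \<alpha> :: "'k \<Rightarrow> real"
  assumes [measurable]: "\<And>j. Z j \<in> borel_measurable M"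
    and indep: "indep_vars (\<lambda>_. borel) Z UNIV"
    and distr: "\<And>j. distr M borel (Z j) = uniform_sphere"
    and s: "0 \<le> s" "2 * (s * (\<Sum>j\<in>UNIV. (\<alpha> j)\<^sup>2)) < real CARD('n)"
  shows "(\<integral>\<^sup>+\<omega>. ennreal (exp (s * (norm (\<Sum>j\<in>UNIV. \<alpha> j *\<^sub>R Z j \<omega>))\<^sup>2)) \<partial>M)
     \<le> ennreal ((1 / sqrt (1 - 2 * (s * (\<Sum>j\<in>UNIV. (\<alpha> j)\<^sup>2) / real CARD('n)))) ^ CARD('n))"
proof -
  define L where "L = real CARD('n)"
  define A where "A = (\<Sum>j\<in>UNIV. (\<alpha> j)\<^sup>2)"
  \<comment> \<open>Chosen so that half the squared norm of \<open>c *\<^sub>R X \<omega>\<close> is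
    \<open>s\<close> times that of \<open>X \<omega>\<close>.\<close>
  define c where "c = sqrt (2 * s)"
  have L: "L > 0" by (simp add: L_def)
  have c2: "c\<^sup>2 = 2 * s" using s by (simp add: c_def)
  define X where "X \<omega> = (\<Sum>j\<in>UNIV. \<alpha> j *\<^sub>R Z j \<omega>)" for \<omega>
  have [measurable]: "X \<in> borel_measurable M" unfolding X_def by measurable
  interpret pair_sigma_finite lborel M
    by (simp add: pair_sigma_finite_def sigma_finite_measure_axioms sigma_finite_lborel)
  \<comment> \<open>For fixed \<open>g\<close> the j-th factor is the sphere estimate at
    \<open>v = (c * \<alpha> j) *\<^sub>R g\<close>; the exponents add up to a multiple of
    \<open>A\<close>.\<close>
  have inner: "(\<integral>\<^sup>+\<omega>. ennreal (exp (g \<bullet> (c *\<^sub>R X \<omega>))) \<partial>M) \<le> ennreal (exp (s * A / L * (norm g)\<^sup>2))" for g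
  proof -
    have "ennreal (exp (g \<bullet> (c *\<^sub>R X \<omega>))) = (\<Prod>j\<in>UNIV. ennreal (exp (((c * \<alpha> j) *\<^sub>R g) \<bullet> Z j \<omega>)))" for \<omega>
      by (simp add: X_def prod_ennreal exp_sum[symmetric] inner_sum_right sum_distrib_left ac_simps)
    then have "(\<integral>\<^sup>+\<omega>. ennreal (exp (g \<bullet> (c *\<^sub>R X \<omega>))) \<partial>M) =
        (\<Prod>j\<in>UNIV. \<integral>\<^sup>+\<omega>. ennreal (exp (((c * \<alpha> j) *\<^sub>R g) \<bullet> Z j \<omega>)) \<partial>M)"
      using indep_vars_nn_integral[OF _ indep_vars_compose2[OF indep,
          of "\<lambda>j z. ennreal (exp (((c * \<alpha> j) *\<^sub>R g) \<bullet> z))"]] by simp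
    also have "\<dots> \<le> (\<Prod>j\<in>UNIV. ennreal (exp ((norm ((c * \<alpha> j) *\<^sub>R g))\<^sup>2 / (2 * L))))"
    proof (rule prod_mono_ennreal)
      fix j :: 'k
      have "(\<integral>\<^sup>+\<omega>. ennreal (exp (((c * \<alpha> j) *\<^sub>R g) \<bullet> Z j \<omega>)) \<partial>M) =
          (\<integral>\<^sup>+z. ennreal (exp (((c * \<alpha> j) *\<^sub>R g) \<bullet> z)) \<partial>distr M borel (Z j))"
        by (subst nn_integral_distr) simp_all
      then show "(\<integral>\<^sup>+\<omega>. ennreal (exp (((c * \<alpha> j) *\<^sub>R g) \<bullet> Z j \<omega>)) \<partial>M)
          \<le> ennreal (exp ((norm ((c * \<alpha> j) *\<^sub>R g))\<^sup>2 / (2 * L)))"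
        unfolding distr L_def using uniform_sphere_subgaussian[of "(c * \<alpha> j) *\<^sub>R g"] by metis
    qed
    also have "\<dots> = ennreal (exp (\<Sum>j\<in>UNIV. (norm ((c * \<alpha> j) *\<^sub>R g))\<^sup>2 / (2 * L)))"
      by (simp add: prod_ennreal exp_sum)
    also have "(\<Sum>j\<in>UNIV. (norm ((c * \<alpha> j) *\<^sub>R g))\<^sup>2 / (2 * L)) = (\<Sum>j\<in>UNIV. (\<alpha> j)\<^sup>2 * (s / L * (norm g)\<^sup>2))"
      using L by (intro sum.cong) (simp_all add: power_mult_distrib c2 field_simps)
    also have "\<dots> = s * A / L * (norm g)\<^sup>2"
      unfolding A_def sum_distrib_right[symmetric] by simp
    finally show ?thesis .
  qed
  have "(\<integral>\<^sup>+\<omega>. ennreal (exp (s * (norm (X \<omega>))\<^sup>2)) \<partial>M) =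
      (\<integral>\<^sup>+\<omega>. \<integral>\<^sup>+g. ennreal (gauss_density g) * ennreal (exp (g \<bullet> (c *\<^sub>R X \<omega>))) \<partial>lborel \<partial>M)"
    unfolding nn_integral_gauss_exp_inner by (simp add: power_mult_distrib c2)
  also have "\<dots> = (\<integral>\<^sup>+g. \<integral>\<^sup>+\<omega>. ennreal (gauss_density g) * ennreal (exp (g \<bullet> (c *\<^sub>R X \<omega>))) \<partial>M \<partial>lborel)"
    by (rule Fubini') simp
  also have "\<dots> = (\<integral>\<^sup>+g. ennreal (gauss_density g) * (\<integral>\<^sup>+\<omega>. ennreal (exp (g \<bullet> (c *\<^sub>R X \<omega>))) \<partial>M) \<partial>lborel)"
    by (simp add: nn_integral_cmult)
  also have "\<dots> \<le> (\<integral>\<^sup>+(g :: real ^ 'n). ennreal (gauss_density g) * ennreal (exp (s * A / L * (norm g)\<^sup>2)) \<partial>lborel)"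
    by (intro nn_integral_mono mult_left_mono inner) simp
  also have "\<dots> = ennreal ((1 / sqrt (1 - 2 * (s * A / L))) ^ CARD('n))"
    using s L by (subst nn_integral_gauss_exp_norm_sq) (simp_all add: A_def L_def field_simps)
  finally show ?thesis by (simp add: X_def A_def L_def)
qed

section \<open>Complex coefficients and the Chernoff bound\<close>

text \<open>The vectors are real, so real and imaginary parts separate in each coordinate. Both real
  sums are built from the same vectors and need not be independent once these are random, which is
  why their exponentials are later combined by convexity.\<close>

lemma norm_sq_complex_combination:
  fixes a :: "complex ^ 'k::finite" and z :: "'k \<Rightarrow> real ^ 'n"
  shows "(norm (\<Sum>j\<in>UNIV. (a $ j) *s cvec (z j)))\<^sup>2 =
    (norm (\<Sum>j\<in>UNIV. Re (a $ j) *\<^sub>R z j))\<^sup>2 + (norm (\<Sum>j\<in>UNIV. Im (a $ j) *\<^sub>R z j))\<^sup>2"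
  by (simp add: norm_vec_def L2_set_def sum_nonneg cmod_power2 cvec_def sum.distrib)

lemma norm_sq_complex_vec:
  "(norm (a :: complex ^ 'k::finite))\<^sup>2 = (\<Sum>j\<in>UNIV. (Re (a $ j))\<^sup>2) + (\<Sum>j\<in>UNIV. (Im (a $ j))\<^sup>2)"
  by (simp add: norm_vec_def L2_set_def sum_nonneg cmod_power2 sum.distrib)

theorem theorem2:
  fixes M :: "'a measure"
    and Z :: "'k::finite \<Rightarrow> 'a \<Rightarrow> real ^ 'n"
    and a :: "complex ^ 'k"
    and u :: real
  assumes "prob_space M"
    and "\<And>j. Z j \<in> borel_measurable M"
    and "prob_space.indep_vars M (\<lambda>_. borel) Z UNIV"
    and "\<And>j. distr M borel (Z j) = uniform_sphere"
    and "a \<noteq> 0"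
    and "u > 1"
  shows "measure M {\<omega> \<in> space M. norm (\<Sum>j\<in>UNIV. (a $ j) *s cvec (Z j \<omega>)) \<ge> u * norm a}
           \<le> exp (- (real CARD('n) / 2) * (u\<^sup>2 - ln (u\<^sup>2) - 1))"
proof -
  interpret prob_space M by fact
  note [measurable] = assms(2)
  define L where "L = real CARD('n)"
  \<comment> \<open>The minimiser of
    \<open>- \<sigma> * u\<^sup>2 - L / 2 * ln (1 - 2 * \<sigma> / L)\<close>, characterised by
    \<open>1 - 2 * \<sigma> / L = 1 / u\<^sup>2\<close>.\<close>
  define \<sigma> where "\<sigma> = L / 2 * (1 - 1 / u\<^sup>2)"
  define N where "N = (norm a)\<^sup>2"
  define A where "A = (\<Sum>j\<in>UNIV. (Re (a $ j))\<^sup>2)"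
  define B where "B = (\<Sum>j\<in>UNIV. (Im (a $ j))\<^sup>2)"
  define X where "X \<omega> = (\<Sum>j\<in>UNIV. Re (a $ j) *\<^sub>R Z j \<omega>)" for \<omega>
  define Y where "Y \<omega> = (\<Sum>j\<in>UNIV. Im (a $ j) *\<^sub>R Z j \<omega>)" for \<omega>
  have [measurable]: "X \<in> borel_measurable M" "Y \<in> borel_measurable M"
    unfolding X_def Y_def by measurable
  have L: "L > 0" by (simp add: L_def)
  have u2: "u\<^sup>2 > 1" using \<open>u > 1\<close> by (simp add: one_less_power)
  have \<sigma>: "\<sigma> > 0" "2 * \<sigma> < L" using L u2 \<open>u > 1\<close> by (simp_all add: \<sigma>_def right_diff_distrib divide_less_eq)
  have N: "N > 0" "N = A + B"
    using \<open>a \<noteq> 0\<close> by (simp add: N_def) (simp add: N_def A_def B_def norm_sq_complex_vec)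
  have AB: "A \<ge> 0" "B \<ge> 0" by (simp_all add: A_def B_def sum_nonneg)
  \<comment> \<open>The parameter \<open>\<sigma> / D\<close> normalises the coefficients, so the
    moment bound is \<open>u ^ CARD('n)\<close> whatever \<open>D\<close> is. Keeping the weight
    \<open>D / N\<close> on both sides makes \<open>D = 0\<close> trivial.\<close>
  have bound: "ennreal (D / N) * (\<integral>\<^sup>+\<omega>. ennreal (exp (\<sigma> / D * (norm (\<Sum>j\<in>UNIV. \<beta> j *\<^sub>R Z j \<omega>))\<^sup>2)) \<partial>M)
      \<le> ennreal (D / N) * ennreal (u ^ CARD('n))"
    if D: "D = (\<Sum>j\<in>UNIV. (\<beta> j)\<^sup>2)" for \<beta> :: "'k \<Rightarrow> real" and D
  proof (cases "D = 0")
    case False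
    then have "D > 0" using D by (simp add: order_less_le sum_nonneg)
    have "1 - 2 * (\<sigma> / D * D / L) = (1 / u)\<^sup>2"
      using False L u2 by (simp add: \<sigma>_def field_simps)
    then have "1 / sqrt (1 - 2 * (\<sigma> / D * D / L)) = u"
      using \<open>u > 1\<close> by simp
    moreover have "(\<integral>\<^sup>+\<omega>. ennreal (exp (\<sigma> / D * (norm (\<Sum>j\<in>UNIV. \<beta> j *\<^sub>R Z j \<omega>))\<^sup>2)) \<partial>M)
        \<le> ennreal ((1 / sqrt (1 - 2 * (\<sigma> / D * D / L))) ^ CARD('n))"
      unfolding D L_def
      by (rule nn_integral_exp_norm_sq_sphere_sum_le[OF assms(2-4)])
         (use \<open>D > 0\<close> \<sigma> in \<open>simp_all add: D[symmetric] L_def\<close>)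
    ultimately show ?thesis by (intro mult_left_mono) simp_all
  qed simp
  text \<open>A vanishing real or imaginary part needs no separate treatment: its sum is zero, its weight
    is zero, and division by zero yields zero.\<close>
  have convex: "exp (\<sigma> * ((norm (X \<omega>))\<^sup>2 + (norm (Y \<omega>))\<^sup>2) / N)
      \<le> A / N * exp (\<sigma> / A * (norm (X \<omega>))\<^sup>2) + B / N * exp (\<sigma> / B * (norm (Y \<omega>))\<^sup>2)" for \<omega>
  proof -
    have "A = 0 \<Longrightarrow> X \<omega> = 0" "B = 0 \<Longrightarrow> Y \<omega> = 0"
      by (simp_all add: A_def B_def X_def Y_def sum_nonneg_eq_0_iff)
    then have "\<sigma> * ((norm (X \<omega>))\<^sup>2 + (norm (Y \<omega>))\<^sup>2) / N =
        A / N * (\<sigma> / A * (norm (X \<omega>))\<^sup>2) + B / N * (\<sigma> / B * (norm (Y \<omega>))\<^sup>2)"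
      using N(1) by (cases "A = 0"; cases "B = 0") (simp_all add: field_simps)
    moreover have "1 - B / N = A / N" "0 \<le> B / N" "B / N \<le> 1"
      using N AB by (simp_all add: field_simps)
    ultimately show ?thesis
      using convex_onD[OF exp_convex, of "B / N" "\<sigma> / A * (norm (X \<omega>))\<^sup>2" "\<sigma> / B * (norm (Y \<omega>))\<^sup>2"]
      by simp
  qed
  define S where "S = {\<omega> \<in> space M. norm (\<Sum>j\<in>UNIV. (a $ j) *s cvec (Z j \<omega>)) \<ge> u * norm a}"
  define T where "T \<omega> = ennreal (A / N) * ennreal (exp (\<sigma> / A * (norm (X \<omega>))\<^sup>2)) +
      ennreal (B / N) * ennreal (exp (\<sigma> / B * (norm (Y \<omega>))\<^sup>2))" for \<omega>
  have [measurable]: "T \<in> borel_measurable M" unfolding T_def by measurable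
  have T: "(\<integral>\<^sup>+\<omega>. T \<omega> \<partial>M) \<le> ennreal (u ^ CARD('n))"
  proof -
    have "(\<integral>\<^sup>+\<omega>. T \<omega> \<partial>M) \<le> ennreal (A / N) * ennreal (u ^ CARD('n)) + ennreal (B / N) * ennreal (u ^ CARD('n))"
      unfolding T_def using bound[OF A_def] bound[OF B_def]
      by (simp add: nn_integral_add nn_integral_cmult X_def Y_def add_mono)
    also have "\<dots> = ennreal (A / N + B / N) * ennreal (u ^ CARD('n))"
      using N AB by (simp add: distrib_right)
    also have "A / N + B / N = 1" using N by (simp add: add_divide_distrib[symmetric])
    finally show ?thesis by simp
  qed
  \<comment> \<open>Markov's inequality in pointwise form: on \<open>S\<close> the exponent on the
    left of \<open>convex\<close> is at least \<open>\<sigma> * u\<^sup>2\<close>.\<close>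
  have S: "indicator S \<omega> \<le> ennreal (exp (- \<sigma> * u\<^sup>2)) * T \<omega>" for \<omega>
  proof (cases "\<omega> \<in> S")
    case True
    then have "(u * norm a)\<^sup>2 \<le> (norm (\<Sum>j\<in>UNIV. (a $ j) *s cvec (Z j \<omega>)))\<^sup>2"
      using \<open>u > 1\<close> by (intro power_mono) (auto simp: S_def)
    then have "u\<^sup>2 * N \<le> (norm (X \<omega>))\<^sup>2 + (norm (Y \<omega>))\<^sup>2"
      unfolding norm_sq_complex_combination by (simp add: power_mult_distrib N_def X_def Y_def)
    then have "\<sigma> * u\<^sup>2 \<le> \<sigma> * ((norm (X \<omega>))\<^sup>2 + (norm (Y \<omega>))\<^sup>2) / N"
      using \<sigma>(1) N(1) by (simp add: pos_le_divide_eq mult.assoc)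
    then have "exp (\<sigma> * u\<^sup>2) \<le> A / N * exp (\<sigma> / A * (norm (X \<omega>))\<^sup>2) + B / N * exp (\<sigma> / B * (norm (Y \<omega>))\<^sup>2)"
      using convex[of \<omega>] by (meson exp_le_cancel_iff order_trans)
    then have "ennreal (exp (\<sigma> * u\<^sup>2)) \<le> T \<omega>"
      unfolding T_def using N AB
      by (subst ennreal_mult[symmetric], simp, simp, subst ennreal_mult[symmetric], simp, simp,
          subst ennreal_plus[symmetric]) (simp_all add: ennreal_leI del: ennreal_plus)
    from mult_left_mono[OF this, of "ennreal (exp (- \<sigma> * u\<^sup>2))"]
    show ?thesis using True by (simp add: ennreal_mult[symmetric] mult_exp_exp)
  qed simp
  \<comment> \<open>Rewriting the event through the real vectors \<open>X\<close> and
    \<open>Y\<close> reduces its measurability to theirs.\<close>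
  have "S = {\<omega> \<in> space M. (u * norm a)\<^sup>2 \<le> (norm (X \<omega>))\<^sup>2 + (norm (Y \<omega>))\<^sup>2}"
    unfolding S_def X_def Y_def norm_sq_complex_combination[symmetric]
    using \<open>u > 1\<close> by (simp add: power_mono_iff)
  then have [measurable]: "S \<in> sets M" by simp
  have "ennreal (measure M S) = (\<integral>\<^sup>+\<omega>. indicator S \<omega> \<partial>M)"
    by (simp add: emeasure_eq_measure)
  also have "\<dots> \<le> (\<integral>\<^sup>+\<omega>. ennreal (exp (- \<sigma> * u\<^sup>2)) * T \<omega> \<partial>M)"
    by (intro nn_integral_mono S)
  also have "\<dots> \<le> ennreal (exp (- \<sigma> * u\<^sup>2)) * ennreal (u ^ CARD('n))"
    using T by (simp add: nn_integral_cmult mult_left_mono)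
  also have "\<dots> = ennreal (exp (- \<sigma> * u\<^sup>2) * u ^ CARD('n))"
    using \<open>u > 1\<close> by (simp add: ennreal_mult)
  finally have "measure M S \<le> exp (- \<sigma> * u\<^sup>2) * u ^ CARD('n)"
    using \<open>u > 1\<close> by (subst (asm) ennreal_le_iff) simp_all
  also have "u ^ CARD('n) = exp (L * ln u)"
    using \<open>u > 1\<close> by (simp add: L_def exp_of_nat_mult)
  also have "exp (- \<sigma> * u\<^sup>2) * exp (L * ln u) = exp (- (L / 2) * (u\<^sup>2 - ln (u\<^sup>2) - 1))"
  proof -
    have "\<sigma> * u\<^sup>2 = L / 2 * (u\<^sup>2 - 1)" using \<open>u > 1\<close> by (simp add: \<sigma>_def field_simps)
    moreover have "ln (u\<^sup>2) = 2 * ln u" using \<open>u > 1\<close> by (simp add: ln_realpow)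
    ultimately show ?thesis by (simp add: mult_exp_exp algebra_simps)
  qed
  finally show ?thesis by (simp add: S_def L_def)
qed

end
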